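(* Let $1\le p<\infty$ and let $D=\{D_1,D_2,\dots,D_n\}\subset(\mathcal{D},W_p)$ be a finite set of persistence diagrams. Then there exists an embedding $f\colon D\to\mathcal{P}_p(\mathbb{R}^2)$ such that for all $i,j$, $$W_p(D_i,D_j)\le W_p(f(D_i),f(D_j))\le 2^{1/p}\,W_p(D_i,D_j).$$
   Context: Throughout $\mathbb{R}^2$ carries the $\ell^\infty$ distance $d(x,y)=\|x-y\|_\infty$. Wasserstein space: for $1\le p<\infty$, $\mathcal{P}_p(\mathbb{R}^2)$ is the set of Borel probability measures on $\mathbb{R}^2$ with finite $p$-th moment, with the metric $W_p(\alpha,\beta)=\left(\inf_{\gamma}\int d(x,y)^p\,d\gamma(x,y)\right)^{1/p}$, where $\gamma$ ranges over Borel probability measures on $\mathbb{R}^2\times\mathbb{R}^2$ with marginals $\alpha$ and $\beta$. Persistence diagrams: let $\mathbb{R}^2_<=\{(b,d)\in\mathbb{R}^2: b<d\}$ and $\Delta_{\mathbb{R}}=\{(x,x): x\in\mathbb{R}\}$. A persistence diagram is a finite multiset of points of $\mathbb{R}^2_<$ (possibly empty); $\mathcal{D}$ is the set of all of them. A partial matching between $D_1,D_2\in\mathcal{D}$ is a triple $(B_1,B_2,f)$ with $B_1\subseteq D_1$, $B_2\subseteq D_2$ (sub-multisets) and $f\colon B_1\to B_2$ a bijection. Its $p$-cost is $$\mathrm{cost}_p(f)=\Big(\sum_{x\in B_1}d(x,f(x))^p+\sum_{x\in D_1\setminus B_1}d(x,\Delta_{\mathbb{R}})^p+\sum_{x\in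 D_2\setminus B_2}d(x,\Delta_{\mathbb{R}})^p\Big)^{1/p}.$$ The $p$-Wasserstein distance $W_p(D_1,D_2)$ is the infimum of $\mathrm{cost}_p(f)$ over all partial matchings between $D_1$ and $D_2$. The symbol $W_p$ is used for both the distance between measures and the distance between diagrams. *)

theory Defs
  imports "HOL-Probability.Probability"
begin

text \<open>
  The plane is \<open>real \<times> real\<close>; its library metric is the Euclidean one, so the
  sup-norm distance is always written out with \<^const>\<open>infnorm\<close>. Both induce the same
  Borel sets.
\<close>

abbreviation dinf :: "real \<times> real \<Rightarrow> real \<times> real \<Rightarrow> real" where
  "dinf x y \<equiv> infnorm (x - y)"

section \<open>Wasserstein space\<close>

definition wasserstein_space :: "real \<Rightarrow> (real \<times> real) measure set" where
  "wasserstein_space p =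
     {\<mu>. prob_space \<mu> \<and> sets \<mu> = sets borel \<and> integrable \<mu> (\<lambda>x. dinf x 0 powr p)}"

definition couplings ::
  "(real \<times> real) measure \<Rightarrow> (real \<times> real) measure \<Rightarrow> ((real \<times> real) \<times> (real \<times> real)) measure set" where
  "couplings \<mu> \<nu> =
     {\<gamma>. prob_space \<gamma> \<and> sets \<gamma> = sets borel \<and> distr \<gamma> borel fst = \<mu> \<and> distr \<gamma> borel snd = \<nu>}"

text \<open>
  The infimum is taken in the extended nonnegative reals, so that a coupling of infinite cost
  does not count as zero. It is finite for measures in \<open>wasserstein_space p\<close>; only
  there is the conversion to a real number meaningful.
\<close>

definition wasserstein_measure ::
  "real \<Rightarrow> (real \<times> real) measure \<Rightarrow> (real \<times> real) measure \<Rightarrow> real" where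
  "wasserstein_measure p \<mu> \<nu> =
     enn2real (INF \<gamma>\<in>couplings \<mu> \<nu>. \<integral>\<^sup>+ z. ennreal (dinf (fst z) (snd z) powr p) \<partial>\<gamma>) powr (1 / p)"

section \<open>Persistence diagrams\<close>

definition diagrams :: "(real \<times> real) multiset set" where
  "diagrams = {D. set_mset D \<subseteq> {(b, d). b < d}}"

definition diagonal :: "(real \<times> real) set" where
  "diagonal = {(x, x) | x. True}"

definition diag_dist :: "real \<times> real \<Rightarrow> real" where
  "diag_dist x = (INF y\<in>diagonal. dinf x y)"

text \<open>
  A bijection between multisets is a bijection between their sets of tagged elements, in which
  a point of multiplicity \<open>m\<close> occurs once for each tag \<open>0, \<dots>, m - 1\<close>.
\<close>

definition tagged :: "'a multiset \<Rightarrow> ('a \<times> nat) set" where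
  "tagged B = {(x, i). i < count B x}"

type_synonym matching =
  "(real \<times> real) multiset \<times> (real \<times> real) multiset \<times> ((real \<times> real) \<times> nat \<Rightarrow> (real \<times> real) \<times> nat)"

definition partial_matchings ::
  "(real \<times> real) multiset \<Rightarrow> (real \<times> real) multiset \<Rightarrow> matching set" where
  "partial_matchings D1 D2 =
     {(B1, B2, f). B1 \<subseteq># D1 \<and> B2 \<subseteq># D2 \<and> bij_betw f (tagged B1) (tagged B2)}"

fun matching_cost ::
  "real \<Rightarrow> (real \<times> real) multiset \<Rightarrow> (real \<times> real) multiset \<Rightarrow> matching \<Rightarrow> real" where
  "matching_cost p D1 D2 (B1, B2, f) =
     ((\<Sum>a\<in>tagged B1. dinf (fst a) (fst (f a)) powr p)
      + (\<Sum>x\<in>#D1 - B1. diag_dist x powr p)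
      + (\<Sum>x\<in>#D2 - B2. diag_dist x powr p)) powr (1 / p)"

definition wasserstein_diagram ::
  "real \<Rightarrow> (real \<times> real) multiset \<Rightarrow> (real \<times> real) multiset \<Rightarrow> real" where
  "wasserstein_diagram p D1 D2 = (INF m\<in>partial_matchings D1 D2. matching_cost p D1 D2 m)"

end

theory Submission
  imports Defs
begin

text \<open>
  For each \<open>D\<close> in the family, project all points of the other diagrams to the
  diagonal and add them to \<open>D\<close>. All diagrams then have the same number \<open>M\<close> of points, and the
  points are scaled by \<open>M powr (1 / p)\<close> to compensate for the weight \<open>1 / M\<close> of each
  atom in the normalised counting measure. A coupling of two such measures costs at least as
  much as some bijection of the index set (Birkhoff--von Neumann), and a bijection restricts to
  a partial matching of no larger cost. Conversely, a partial matching extends to a bijection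
  in which every matched pair is used a second time between the diagonal projections; as
  the projection is 1-Lipschitz, the \<open>p\<close>-th power of the cost at most doubles.
\<close>

section \<open>Hall's theorem and permutations of least cost\<close>

text \<open>Induction on \<open>card I\<close>. If some proper nonempty \<open>J\<close> is tight,
  that is, has exactly \<open>card J\<close> candidates, then representatives for \<open>J\<close>
  use up all of \<open>U\<close>, and the remaining indices are solved separately inside the sets
  \<open>A i - U\<close>. If no such \<open>J\<close> exists, every proper nonempty subfamily has a
  candidate to spare, so an arbitrary choice \<open>x\<close> for one index \<open>i\<close> can be
  removed from the other sets.\<close>

lemma hall_marriage:
  assumes "finite I" "\<And>i. i \<in> I \<Longrightarrow> finite (A i)"
    and "\<And>J. J \<subseteq> I \<Longrightarrow> card J \<le> card (\<Union>(A ` J))"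
  shows "\<exists>R. (\<forall>i\<in>I. R i \<in> A i) \<and> inj_on R I"
  using assms
proof (induction "card I" arbitrary: I A rule: less_induct)
  case less
  note fin = less.prems(1,2) and hall = less.prems(3)
  show ?case
  proof (cases "\<exists>J. J \<subset> I \<and> J \<noteq> {} \<and> card J = card (\<Union>(A ` J))")
    case True
    then obtain J where J: "J \<subset> I" "J \<noteq> {}" "card J = card (\<Union>(A ` J))" by blast
    define U where "U = \<Union>(A ` J)"
    have finJ: "finite J" using J fin(1) finite_subset by blast
    have finU: "finite U" unfolding U_def using J fin finJ by blast
    have "card J < card I" using J fin(1) psubset_card_mono by blast
    then have "\<exists>R. (\<forall>i\<in>J. R i \<in> A i) \<and> inj_on R J"
      using finJ J(1) by (intro less.hyps fin(2) hall) auto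
    then obtain R where R: "\<forall>i\<in>J. R i \<in> A i" "inj_on R J" by blast
    have "card (I - J) < card I"
      using J fin(1) by (intro psubset_card_mono) auto
    moreover have "card K \<le> card (\<Union>((\<lambda>i. A i - U) ` K))" if K: "K \<subseteq> I - J" for K
    proof -
      have finK: "finite K" using K fin(1) finite_subset by blast
      have finV: "finite (\<Union>((\<lambda>i. A i - U) ` K))" using K finK fin(2) by blast
      \<comment> \<open>Hall's condition for \<open>K \<union> J\<close> minus the tight equality
        for \<open>J\<close> gives the condition for \<open>K\<close> after removal of
        \<open>U\<close>.\<close>
      have "card K + card J = card (K \<union> J)"
        using K finK finJ by (subst card_Un_disjoint) auto
      also have "\<dots> \<le> card (\<Union>(A ` (K \<union> J)))" using K J by (intro hall) auto
      also have "\<Union>(A ` (K \<union> J)) = \<Union>((\<lambda>i. A i - U) ` K) \<union> U" unfolding U_def by blast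
      also have "card \<dots> = card (\<Union>((\<lambda>i. A i - U) ` K)) + card U"
        using finU finV by (intro card_Un_disjoint) auto
      finally show ?thesis using J(3) U_def by simp
    qed
    ultimately have "\<exists>Q. (\<forall>i\<in>I - J. Q i \<in> A i - U) \<and> inj_on Q (I - J)"
      using fin by (intro less.hyps) auto
    then obtain Q where Q: "\<forall>i\<in>I - J. Q i \<in> A i - U" "inj_on Q (I - J)" by blast
    let ?R = "\<lambda>i. if i \<in> J then R i else Q i"
    have RU: "R i \<in> U" if "i \<in> J" for i using R that U_def by blast
    have "inj_on ?R I"
    proof (rule inj_onI)
      fix i j assume *: "i \<in> I" "j \<in> I" "?R i = ?R j"
      show "i = j"
      proof (cases "i \<in> J \<longleftrightarrow> j \<in> J")
        case True
        then show ?thesis using * R(2) Q(2) by (auto split: if_splits dest: inj_onD)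
      next
        case False
        then show ?thesis using * RU Q(1) by (metis DiffD2 DiffI)
      qed
    qed
    moreover have "\<forall>i\<in>I. ?R i \<in> A i" using R Q by auto
    ultimately show ?thesis by (intro exI[of _ ?R] conjI)
  next
    case noJ: False
    show ?thesis
    proof (cases "I = {}")
      case True
      then show ?thesis by simp
    next
      case neI: False
      then obtain i where i: "i \<in> I" by blast
      have "card {i} \<le> card (A i)" using hall[of "{i}"] i by simp
      then obtain x where x: "x \<in> A i" by fastforce
      have "card (I - {i}) < card I" using i fin(1) by (intro psubset_card_mono) auto
      moreover have card_Suc_Diff1_le: "card V \<le> Suc (card (V - {x}))" for V
        by (auto simp: card_Diff_singleton_if)
      moreover have "card K \<le> card (\<Union>((\<lambda>j. A j - {x}) ` K))" if K: "K \<subseteq> I - {i}" for K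
      proof (cases "K = {}")
        case False
        have "K \<subset> I" using K i by blast
        \<comment> \<open>\<open>K\<close> misses \<open>i\<close>, so it is proper and not tight;
          the inequality is strict and survives the loss of \<open>x\<close>.\<close>
        then have "card K < card (\<Union>(A ` K))"
          using hall[of K] noJ False by (metis order_le_less psubset_imp_subset)
        also have "\<dots> \<le> Suc (card (\<Union>(A ` K) - {x}))"
          using card_Suc_Diff1_le .
        also have "\<Union>(A ` K) - {x} = \<Union>((\<lambda>j. A j - {x}) ` K)" by blast
        finally show ?thesis by simp
      qed simp
      ultimately have "\<exists>Q. (\<forall>j\<in>I - {i}. Q j \<in> A j - {x}) \<and> inj_on Q (I - {i})"
        using fin by (intro less.hyps) auto
      then obtain Q where Q: "\<forall>j\<in>I - {i}. Q j \<in> A j - {x}" "inj_on Q (I - {i})" by blast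
      have "inj_on (Q(i := x)) I"
        using Q unfolding inj_on_def by (metis DiffD2 DiffI fun_upd_apply insertI1 singletonD)
      moreover have "\<forall>j\<in>I. (Q(i := x)) j \<in> A j" using Q x by auto
      ultimately show ?thesis by blast
    qed
  qed
qed

text \<open>The rows in \<open>J\<close> carry total mass \<open>s * card J\<close>, all of it in
  the columns of \<open>?U\<close>, whose full mass is \<open>s * card ?U\<close>. Hence the
  positive entries satisfy Hall's condition, and an injective choice on the finite set
  \<open>T\<close> is a bijection.\<close>

lemma positive_diagonal:
  fixes A :: "'a \<Rightarrow> 'a \<Rightarrow> real"
  assumes fin: "finite T" and nn: "\<And>t u. t \<in> T \<Longrightarrow> u \<in> T \<Longrightarrow> 0 \<le> A t u"
    and row: "\<And>t. t \<in> T \<Longrightarrow> (\<Sum>u\<in>T. A t u) = s"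
    and col: "\<And>u. u \<in> T \<Longrightarrow> (\<Sum>t\<in>T. A t u) = s" and s: "0 < s"
  shows "\<exists>\<sigma>. bij_betw \<sigma> T T \<and> (\<forall>t\<in>T. 0 < A t (\<sigma> t))"
proof -
  let ?N = "\<lambda>t. {u \<in> T. 0 < A t u}"
  have "card J \<le> card (\<Union>(?N ` J))" if J: "J \<subseteq> T" for J
  proof -
    let ?U = "\<Union>(?N ` J)"
    have finJ: "finite J" and U: "?U \<subseteq> T" using J fin finite_subset by auto
    have "s * card J = (\<Sum>t\<in>J. \<Sum>u\<in>T. A t u)" using row J by (simp add: subset_iff)
    also have "\<dots> = (\<Sum>t\<in>J. \<Sum>u\<in>?U. A t u)"
    proof (rule sum.cong[OF refl])
      fix t assume t: "t \<in> J"
      have "A t u = 0" if "u \<in> T - ?U" for u using nn[of t u] J t that by force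
      then show "(\<Sum>u\<in>T. A t u) = (\<Sum>u\<in>?U. A t u)"
        using U fin by (intro sum.mono_neutral_right) auto
    qed
    also have "\<dots> = (\<Sum>u\<in>?U. \<Sum>t\<in>J. A t u)" by (rule sum.swap)
    also have "\<dots> \<le> (\<Sum>u\<in>?U. \<Sum>t\<in>T. A t u)"
      using J U fin nn by (intro sum_mono sum_mono2) auto
    also have "\<dots> = s * card ?U" using col U by (simp add: subset_iff)
    finally show ?thesis using s by simp
  qed
  then obtain \<sigma> where \<sigma>: "\<forall>t\<in>T. \<sigma> t \<in> ?N t" "inj_on \<sigma> T"
    using hall_marriage[of T ?N] fin by auto
  then have "\<sigma> ` T = T" using fin by (intro card_subset_eq) (auto simp: card_image)
  then show ?thesis using \<sigma> by (intro exI[of _ \<sigma>]) (auto simp: bij_betw_def)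
qed

text \<open>The linear-programming form of the Birkhoff--von Neumann theorem.\<close>

lemma exists_permutation_cost_le:
  fixes A cost :: "'a \<Rightarrow> 'a \<Rightarrow> real"
  assumes fin: "finite T" and nn: "\<And>t u. t \<in> T \<Longrightarrow> u \<in> T \<Longrightarrow> 0 \<le> A t u"
    and row: "\<And>t. t \<in> T \<Longrightarrow> (\<Sum>u\<in>T. A t u) = s"
    and col: "\<And>u. u \<in> T \<Longrightarrow> (\<Sum>t\<in>T. A t u) = s"
  shows "\<exists>\<sigma>. bij_betw \<sigma> T T \<and>
    s * (\<Sum>t\<in>T. cost t (\<sigma> t)) \<le> (\<Sum>t\<in>T. \<Sum>u\<in>T. A t u * cost t u)"
  using nn row col
proof (induction "card {(t, u) \<in> T \<times> T. A t u \<noteq> 0}" arbitrary: A s rule: less_induct)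
  case less
  note nn = less.prems(1) and row = less.prems(2) and col = less.prems(3)
  show ?case
  proof (cases "T = {} \<or> s = 0")
    case True
    \<comment> \<open>All entries vanish on \<open>T\<close>, so both sides are zero and the
      identity serves as the permutation.\<close>
    have "A t u = 0" if "t \<in> T" "u \<in> T" for t u
      using True row[of t] nn that fin by (auto simp: sum_nonneg_eq_0_iff)
    then have "s * (\<Sum>t\<in>T. cost t (id t)) \<le> (\<Sum>t\<in>T. \<Sum>u\<in>T. A t u * cost t u)"
      using True by auto
    then show ?thesis using bij_betw_id by blast
  next
    case False
    then have "0 < s" using nn row by (metis equals0I order_le_less sum_nonneg)
    then obtain \<tau> where \<tau>: "bij_betw \<tau> T T" "\<And>t. t \<in> T \<Longrightarrow> 0 < A t (\<tau> t)"
      using positive_diagonal[OF fin nn row col] by blast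
    have \<tau>T: "\<tau> t \<in> T" if "t \<in> T" for t using \<tau>(1) that bij_betwE by blast
    \<comment> \<open>\<open>e\<close> is the largest multiple of the permutation matrix of
      \<open>\<tau>\<close> that can be subtracted without making an entry negative. It erases the
      entry at \<open>(t0, \<tau> t0)\<close>, so the support shrinks and the induction applies with
      row sum \<open>s - e\<close>.\<close>
    define e where "e = Min ((\<lambda>t. A t (\<tau> t)) ` T)"
    have "e \<in> (\<lambda>t. A t (\<tau> t)) ` T" unfolding e_def using fin False by (intro Min_in) auto
    then obtain t0 where t0: "t0 \<in> T" "e = A t0 (\<tau> t0)" by blast
    have e_le: "e \<le> A t (\<tau> t)" if "t \<in> T" for t unfolding e_def using fin that by (intro Min_le) auto
    have e0: "0 < e" using \<tau>(2) t0 by simp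
    define A' where "A' t u = A t u - (if u = \<tau> t then e else 0)" for t u
    have nn': "0 \<le> A' t u" if "t \<in> T" "u \<in> T" for t u
      using nn e_le that by (simp add: A'_def)
    have row': "(\<Sum>u\<in>T. A' t u) = s - e" if "t \<in> T" for t
      using row[OF that] \<tau>T[OF that] fin by (simp add: A'_def sum_subtractf)
    have col': "(\<Sum>t\<in>T. A' t u) = s - e" if u: "u \<in> T" for u
    proof -
      \<comment> \<open>The permutation matrix meets column \<open>u\<close> exactly once, in row
        \<open>r\<close>.\<close>
      obtain r where r: "r \<in> T" "\<tau> r = u" using \<tau>(1) u by (metis bij_betw_imp_surj_on imageE)
      have "(\<Sum>t\<in>T. if u = \<tau> t then e else 0) = (\<Sum>t\<in>T. if t = r then e else 0)"
        using r \<tau>(1) by (intro sum.cong refl) (auto simp: bij_betw_def inj_on_def)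
      then show ?thesis using col[OF u] r fin by (simp add: A'_def sum_subtractf)
    qed
    have "card {(t, u) \<in> T \<times> T. A' t u \<noteq> 0} < card {(t, u) \<in> T \<times> T. A t u \<noteq> 0}"
    proof (rule psubset_card_mono)
      show "finite {(t, u) \<in> T \<times> T. A t u \<noteq> 0}"
        using fin by (auto intro: finite_subset[of _ "T \<times> T"])
      have "{(t, u) \<in> T \<times> T. A' t u \<noteq> 0} \<subseteq> {(t, u) \<in> T \<times> T. A t u \<noteq> 0}"
        using \<tau>(2) by (force simp: A'_def split: if_splits)
      moreover have "(t0, \<tau> t0) \<in> {(t, u) \<in> T \<times> T. A t u \<noteq> 0} - {(t, u) \<in> T \<times> T. A' t u \<noteq> 0}"
        using t0 \<tau>T e0 by (auto simp: A'_def)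
      ultimately show "{(t, u) \<in> T \<times> T. A' t u \<noteq> 0} \<subset> {(t, u) \<in> T \<times> T. A t u \<noteq> 0}" by blast
    qed
    then obtain \<rho> where \<rho>: "bij_betw \<rho> T T"
      "(s - e) * (\<Sum>t\<in>T. cost t (\<rho> t)) \<le> (\<Sum>t\<in>T. \<Sum>u\<in>T. A' t u * cost t u)"
      using less.hyps[of A' "s - e"] nn' row' col' by blast
    have "(\<Sum>u\<in>T. A' t u * cost t u) = (\<Sum>u\<in>T. A t u * cost t u) - e * cost t (\<tau> t)"
      if "t \<in> T" for t
    proof -
      have "A' t u * cost t u = A t u * cost t u - (if u = \<tau> t then e * cost t (\<tau> t) else 0)" for u
        by (simp add: A'_def algebra_simps)
      then show ?thesis using \<tau>T[OF that] fin by (simp add: sum_subtractf)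
    qed
    then have A': "(\<Sum>t\<in>T. \<Sum>u\<in>T. A' t u * cost t u)
        = (\<Sum>t\<in>T. \<Sum>u\<in>T. A t u * cost t u) - e * (\<Sum>t\<in>T. cost t (\<tau> t))"
      by (simp add: sum_subtractf sum_distrib_left)
    have se: "0 \<le> s - e" using row'[OF t0(1)] nn' t0(1) by (metis sum_nonneg)
    \<comment> \<open>The total cost of \<open>A\<close> is at least \<open>e\<close> times the cost
      of \<open>\<tau>\<close> plus \<open>s - e\<close> times the cost of \<open>\<rho>\<close>.
      Both weights are nonnegative, so the cheaper of the two permutations satisfies the bound with
      weight \<open>s\<close>.\<close>
    show ?thesis
    proof (cases "(\<Sum>t\<in>T. cost t (\<tau> t)) \<le> (\<Sum>t\<in>T. cost t (\<rho> t))")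
      case True
      then have "(s - e) * (\<Sum>t\<in>T. cost t (\<tau> t)) \<le> (s - e) * (\<Sum>t\<in>T. cost t (\<rho> t))"
        using se by (rule mult_left_mono)
      then show ?thesis using \<rho>(2) A' \<tau>(1) by (intro exI[of _ \<tau>]) (simp add: algebra_simps)
    next
      case False
      then have "e * (\<Sum>t\<in>T. cost t (\<rho> t)) \<le> e * (\<Sum>t\<in>T. cost t (\<tau> t))"
        using e0 by (intro mult_left_mono) auto
      then show ?thesis using \<rho> A' by (intro exI[of _ \<rho>]) (simp add: algebra_simps)
    qed
  qed
qed

section \<open>The sup norm and uniform measures on indexed points\<close>

lemma infnorm_real_pair: "infnorm x = max \<bar>fst x\<bar> \<bar>snd x\<bar>" for x :: "real \<times> real"
  by (cases x) (simp add: infnorm_Max Basis_prod_def image_Un image_image zero_prod_def[symmetric] max.commute)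

lemma borel_measurable_dinf [measurable]: "(\<lambda>z. dinf (fst z) (snd z)) \<in> borel_measurable borel"
  by (intro borel_measurable_continuous_onI continuous_intros)

lemma borel_measurable_dinf0 [measurable]: "(\<lambda>x. dinf x 0) \<in> borel_measurable borel"
  by (intro borel_measurable_continuous_onI continuous_intros)

lemma borel_measurable_fst_snd [measurable]:
  "(fst :: (real \<times> real) \<times> (real \<times> real) \<Rightarrow> _) \<in> borel_measurable borel"
  "(snd :: (real \<times> real) \<times> (real \<times> real) \<Rightarrow> _) \<in> borel_measurable borel"
  by (intro borel_measurable_continuous_onI continuous_intros)+

text \<open>Indexing by \<open>T\<close> keeps multiplicities: an atom hit by several indices gets
  their joint weight, and permutations of \<open>T\<close> act as transport plans even if
  \<open>g\<close> is not injective.\<close>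

definition uniform_image :: "'a set \<Rightarrow> ('a \<Rightarrow> real \<times> real) \<Rightarrow> (real \<times> real) measure" where
  "uniform_image T g = distr (measure_pmf (pmf_of_set T)) borel g"

lemma measure_uniform_image:
  assumes "finite T" "T \<noteq> {}" "A \<in> sets borel"
  shows "measure (uniform_image T g) A = card {t \<in> T. g t \<in> A} / card T"
proof -
  have "T \<inter> g -` A = {t \<in> T. g t \<in> A}" by blast
  then show ?thesis
    using assms by (simp add: uniform_image_def measure_distr measure_pmf_of_set)
qed

lemma uniform_image_in_wasserstein_space:
  assumes "finite T" "T \<noteq> {}"
  shows "uniform_image T g \<in> wasserstein_space p"
proof -
  have "(\<lambda>x. dinf x 0 powr p) \<in> borel_measurable borel"
    using borel_measurable_dinf0 by measurable
  then have "integrable (uniform_image T g) (\<lambda>x. dinf x 0 powr p)"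
    unfolding uniform_image_def
    using assms by (subst integrable_distr_eq) (simp_all add: integrable_measure_pmf_finite)
  then show ?thesis
    by (simp add: wasserstein_space_def uniform_image_def measure_pmf.prob_space_distr)
qed

text \<open>The plan is the law of the pair \<open>(g t, h (\<sigma> t))\<close> for uniform
  \<open>t\<close>. Its second marginal is correct because a permutation preserves the uniform law
  on \<open>T\<close>.\<close>

lemma uniform_image_coupling:
  assumes T: "finite T" "T \<noteq> {}" and \<sigma>: "bij_betw \<sigma> T T"
  shows "\<exists>\<gamma>\<in>couplings (uniform_image T g) (uniform_image T h).
    (\<integral>\<^sup>+ z. ennreal (dinf (fst z) (snd z) powr p) \<partial>\<gamma>)
      = ennreal ((\<Sum>t\<in>T. dinf (g t) (h (\<sigma> t)) powr p) / card T)"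
proof -
  let ?P = "measure_pmf (pmf_of_set T)"
  define \<gamma> where "\<gamma> = distr ?P (borel :: ((real \<times> real) \<times> (real \<times> real)) measure) (\<lambda>t. (g t, h (\<sigma> t)))"
  have *: "distr ?P borel (h \<circ> \<sigma>) = distr ?P borel h"
  proof -
    have "map_pmf \<sigma> (pmf_of_set T) = pmf_of_set (\<sigma> ` T)"
      using T \<sigma> by (intro map_pmf_of_set_inj) (auto simp: bij_betw_def)
    then have "pmf_of_set T = map_pmf \<sigma> (pmf_of_set T)"
      using \<sigma> by (simp add: bij_betw_def)
    then have "distr ?P borel h = distr (distr ?P (count_space UNIV) \<sigma>) borel h"
      by (metis map_pmf_rep_eq)
    then show ?thesis by (simp add: distr_distr)
  qed
  have "\<gamma> \<in> couplings (uniform_image T g) (uniform_image T h)"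
    using * by (simp add: couplings_def \<gamma>_def uniform_image_def measure_pmf.prob_space_distr
        distr_distr comp_def borel_measurable_Pair)
  moreover have "(\<integral>\<^sup>+ z. ennreal (dinf (fst z) (snd z) powr p) \<partial>\<gamma>)
      = (\<integral>\<^sup>+ t. ennreal (dinf (g t) (h (\<sigma> t)) powr p) \<partial>?P)"
    unfolding \<gamma>_def by (subst nn_integral_distr) auto
  moreover have "\<dots> = ennreal ((\<Sum>t\<in>T. dinf (g t) (h (\<sigma> t)) powr p) / card T)"
    using T by (simp add: nn_integral_pmf_of_set sum_nonneg ennreal_of_nat_eq_real_of_nat divide_ennreal card_gt_0_iff)
  ultimately show ?thesis by auto
qed

section \<open>From couplings to permutations of the index set\<close>

text \<open>The value at \<open>v\<close> is shared equally among the indices of its fibre. This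
  translates between sums over indices and sums over atoms when a value is taken more than
  once.\<close>

lemma sum_fibres:
  fixes F :: "'b \<Rightarrow> real"
  assumes "finite T"
  shows "(\<Sum>u\<in>T. F (h u) / card {u'\<in>T. h u' = h u}) = (\<Sum>v\<in>h ` T. F v)"
proof -
  have "(\<Sum>u\<in>T. F (h u) / card {u'\<in>T. h u' = h u})
      = (\<Sum>v\<in>h ` T. \<Sum>u\<in>{u\<in>T. h u = v}. F (h u) / card {u'\<in>T. h u' = h u})"
    by (rule sum.image_gen[OF assms])
  also have "\<dots> = (\<Sum>v\<in>h ` T. F v)"
  proof (rule sum.cong[OF refl])
    fix v assume "v \<in> h ` T"
    then have "card {u\<in>T. h u = v} \<noteq> 0" using assms by auto
    moreover have "(\<Sum>u\<in>{u\<in>T. h u = v}. F (h u) / card {u'\<in>T. h u' = h u})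
        = (\<Sum>u\<in>{u\<in>T. h u = v}. F v / card {u'\<in>T. h u' = v})"
      by (intro sum.cong) auto
    ultimately show "(\<Sum>u\<in>{u\<in>T. h u = v}. F (h u) / card {u'\<in>T. h u' = h u}) = F v" by simp
  qed
  finally show ?thesis .
qed

text \<open>The coupling is concentrated on the finite grid of values of \<open>g\<close> and
  \<open>h\<close>. Its atoms are turned into a matrix on \<open>T\<close> with all row and column
  sums \<open>1 / card T\<close>, whose linear cost is the integral over the grid;
  \<open>exists_permutation_cost_le\<close> then gives a permutation of no larger cost.\<close>

lemma exists_permutation_le_coupling:
  assumes T: "finite T" "T \<noteq> {}"
    and \<gamma>: "\<gamma> \<in> couplings (uniform_image T g) (uniform_image T h)"
  shows "\<exists>\<sigma>. bij_betw \<sigma> T T \<and> ennreal ((\<Sum>t\<in>T. dinf (g t) (h (\<sigma> t)) powr p) / card T)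
    \<le> (\<integral>\<^sup>+ z. ennreal (dinf (fst z) (snd z) powr p) \<partial>\<gamma>)"
proof -
  interpret prob_space \<gamma> using \<gamma> by (simp add: couplings_def)
  have [measurable_cong, simp]: "sets \<gamma> = sets borel" and sp [simp]: "space \<gamma> = UNIV"
    and dg: "distr \<gamma> borel fst = uniform_image T g" and dh: "distr \<gamma> borel snd = uniform_image T h"
    using \<gamma> by (auto simp: couplings_def dest: sets_eq_imp_space_eq)
  have m1 [measurable]: "fst \<in> borel_measurable \<gamma>" and m2 [measurable]: "snd \<in> borel_measurable \<gamma>"
    by (simp_all add: measurable_cong_sets[OF \<open>sets \<gamma> = sets borel\<close> refl] borel_measurable_fst_snd)
  have cl: "S \<in> sets borel" if "finite S" for S :: "((real \<times> real) \<times> (real \<times> real)) set"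
    using that by (simp add: finite_imp_closed borel_closed)
  have cl': "S \<in> sets borel" if "finite S" for S :: "(real \<times> real) set"
    using that by (simp add: finite_imp_closed borel_closed)
  have pfst: "measure \<gamma> (fst -` S) = card {t \<in> T. g t \<in> S} / card T" if "finite S" for S
    using measure_uniform_image[OF T cl'[OF that], of g] cl'[OF that] unfolding dg[symmetric]
    by (subst (asm) measure_distr) auto
  have psnd: "measure \<gamma> (snd -` S) = card {t \<in> T. h t \<in> S} / card T" if "finite S" for S
    using measure_uniform_image[OF T cl'[OF that], of h] cl'[OF that] unfolding dh[symmetric]
    by (subst (asm) measure_distr) auto
  have pre1: "fst -` S \<in> sets (borel :: ((real \<times> real) \<times> (real \<times> real)) measure)"
    if "finite S" for S
    using measurable_sets[OF m1 cl'[OF that]] by simp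
  have pre2: "snd -` S \<in> sets (borel :: ((real \<times> real) \<times> (real \<times> real)) measure)"
    if "finite S" for S
    using measurable_sets[OF m2 cl'[OF that]] by simp
  have prob_UNIV: "prob UNIV = 1" using prob_space by simp
  have full: "measure \<gamma> (fst -` (g ` T)) = 1" "measure \<gamma> (snd -` (h ` T)) = 1"
  proof -
    have "{t \<in> T. g t \<in> g ` T} = T" "{t \<in> T. h t \<in> h ` T} = T" by auto
    then show "measure \<gamma> (fst -` (g ` T)) = 1" "measure \<gamma> (snd -` (h ` T)) = 1"
      using T by (simp_all add: pfst psnd)
  qed
  define m where "m t = card {t' \<in> T. g t' = g t}" for t
  define n where "n u = card {u' \<in> T. h u' = h u}" for u
  have m0: "m t \<noteq> 0" and n0: "n t \<noteq> 0" if "t \<in> T" for t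
    using that T by (auto simp: m_def n_def)
  \<comment> \<open>The atom at \<open>(g t, h u)\<close> is represented by \<open>m t * n u\<close>
    pairs of indices, so its mass is divided evenly among them.\<close>
  define A where "A t u = measure \<gamma> {(g t, h u)} / (m t * n u)" for t u
  have sing: "measure \<gamma> S = (\<Sum>z\<in>S. measure \<gamma> {z})" if "finite S" for S
    using that by (intro finite_measure_eq_sum_singleton) (auto intro: cl)
  have row: "(\<Sum>u\<in>T. A t u) = 1 / card T" if t: "t \<in> T" for t
  proof -
    have "(\<Sum>u\<in>T. A t u) = (\<Sum>u\<in>T. measure \<gamma> {(g t, h u)} / card {u' \<in> T. h u' = h u}) / m t"
      by (simp add: A_def n_def sum_divide_distrib mult.commute)
    also have "\<dots> = (\<Sum>v\<in>h ` T. measure \<gamma> {(g t, v)}) / m t"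
      using sum_fibres[OF T(1), of "\<lambda>v. measure \<gamma> {(g t, v)}" h] by simp
    also have "(\<Sum>v\<in>h ` T. measure \<gamma> {(g t, v)}) = (\<Sum>z\<in>Pair (g t) ` h ` T. measure \<gamma> {z})"
      by (subst sum.reindex) (auto simp: inj_on_def)
    also have "\<dots> = measure \<gamma> (Pair (g t) ` h ` T)" using T by (intro sing[symmetric]) simp
    also have "Pair (g t) ` h ` T = {g t} \<times> h ` T" by auto
    also have "{g t} \<times> h ` T = fst -` {g t} \<inter> snd -` (h ` T)" by auto
    \<comment> \<open>Intersecting with an event of probability one, namely that \<open>snd\<close>
      takes a value of \<open>h\<close>, leaves the measure unchanged.\<close>
    also have "measure \<gamma> \<dots> = measure \<gamma> (fst -` {g t})"
      using T by (intro measure_space_inter) (auto simp: full prob_UNIV intro!: pre1 pre2)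
    also have "\<dots> = m t / card T" by (simp add: pfst m_def)
    finally show ?thesis using m0[OF t] by simp
  qed
  have col: "(\<Sum>t\<in>T. A t u) = 1 / card T" if u: "u \<in> T" for u
  proof -
    have "(\<Sum>t\<in>T. A t u) = (\<Sum>t\<in>T. measure \<gamma> {(g t, h u)} / card {t' \<in> T. g t' = g t}) / n u"
      by (simp add: A_def m_def sum_divide_distrib)
    also have "\<dots> = (\<Sum>v\<in>g ` T. measure \<gamma> {(v, h u)}) / n u"
      using sum_fibres[OF T(1), of "\<lambda>v. measure \<gamma> {(v, h u)}" g] by simp
    also have "(\<Sum>v\<in>g ` T. measure \<gamma> {(v, h u)}) = (\<Sum>z\<in>(\<lambda>v. (v, h u)) ` g ` T. measure \<gamma> {z})"
      by (subst sum.reindex) (auto simp: inj_on_def)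
    also have "\<dots> = measure \<gamma> ((\<lambda>v. (v, h u)) ` g ` T)" using T by (intro sing[symmetric]) simp
    also have "(\<lambda>v. (v, h u)) ` g ` T = g ` T \<times> {h u}" by auto
    also have "g ` T \<times> {h u} = snd -` {h u} \<inter> fst -` (g ` T)" by auto
    also have "measure \<gamma> \<dots> = measure \<gamma> (snd -` {h u})"
      using T by (intro measure_space_inter) (auto simp: full prob_UNIV intro!: pre1 pre2)
    also have "\<dots> = n u / card T" by (simp add: psnd n_def)
    finally show ?thesis using n0[OF u] by simp
  qed
  define d where "d z = dinf (fst z) (snd z) powr p" for z
  obtain \<sigma> where \<sigma>: "bij_betw \<sigma> T T" and
    le: "1 / card T * (\<Sum>t\<in>T. d (g t, h (\<sigma> t))) \<le> (\<Sum>t\<in>T. \<Sum>u\<in>T. A t u * d (g t, h u))"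
    using exists_permutation_cost_le[OF T(1) _ row col, of "\<lambda>t u. d (g t, h u)"]
    by (auto simp: A_def)
  \<comment> \<open>Summing over indices undoes the even division, first in \<open>u\<close> and
    then in \<open>t\<close>.\<close>
  have "(\<Sum>t\<in>T. \<Sum>u\<in>T. A t u * d (g t, h u)) =
      (\<Sum>t\<in>T. (\<Sum>u\<in>T. (measure \<gamma> {(g t, h u)} * d (g t, h u)) / card {u' \<in> T. h u' = h u}) / m t)"
    by (simp add: A_def n_def sum_divide_distrib mult_ac)
  also have "\<dots> = (\<Sum>t\<in>T. (\<Sum>v\<in>h ` T. measure \<gamma> {(g t, v)} * d (g t, v)) / card {t' \<in> T. g t' = g t})"
    unfolding m_def by (subst sum_fibres[OF T(1), of "\<lambda>v. measure \<gamma> {(g t, v)} * d (g t, v)" h for t]) simp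
  also have "\<dots> = (\<Sum>w\<in>g ` T. \<Sum>v\<in>h ` T. measure \<gamma> {(w, v)} * d (w, v))"
    by (rule sum_fibres[OF T(1)])
  also have "\<dots> = (\<Sum>z\<in>g ` T \<times> h ` T. measure \<gamma> {z} * d z)"
    by (simp add: sum.cartesian_product)
  finally have eq: "(\<Sum>t\<in>T. \<Sum>u\<in>T. A t u * d (g t, h u)) = (\<Sum>z\<in>g ` T \<times> h ` T. measure \<gamma> {z} * d z)" .
  have d0: "0 \<le> d z" for z by (simp add: d_def)
  have "ennreal (\<Sum>z\<in>g ` T \<times> h ` T. measure \<gamma> {z} * d z)
      = (\<Sum>z\<in>g ` T \<times> h ` T. ennreal (d z) * emeasure \<gamma> {z})"
    using d0 by (simp add: emeasure_eq_measure ennreal_mult[symmetric] mult.commute flip: sum_ennreal)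
  also have "\<dots> = (\<integral>\<^sup>+ z. ennreal (d z) * indicator (g ` T \<times> h ` T) z \<partial>\<gamma>)"
    using T by (intro nn_integral_indicator_finite[symmetric]) (auto intro: cl)
  also have "\<dots> \<le> (\<integral>\<^sup>+ z. ennreal (d z) \<partial>\<gamma>)"
    by (intro nn_integral_mono) (auto simp: indicator_def)
  finally have "ennreal ((\<Sum>t\<in>T. d (g t, h (\<sigma> t))) / card T) \<le> (\<integral>\<^sup>+ z. ennreal (d z) \<partial>\<gamma>)"
    using le eq by (metis (no_types, lifting) ennreal_leI mult_1 order_trans times_divide_eq_left)
  then show ?thesis using \<sigma> by (auto simp: d_def)
qed

section \<open>Projection to the diagonal\<close>

text \<open>The orthogonal projection is also the nearest diagonal point for the sup norm, so one
  map serves both for the distance to the diagonal and for the Lipschitz estimate.\<close>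

definition diag_proj :: "real \<times> real \<Rightarrow> real \<times> real" where
  "diag_proj x = ((fst x + snd x) / 2, (fst x + snd x) / 2)"

lemma diag_proj_in_diagonal [simp]: "diag_proj x \<in> diagonal"
  unfolding diag_proj_def diagonal_def by blast

lemma dinf_sym: "dinf x y = dinf y x"
  by (rule infnorm_sub)

lemma diag_dist_le: "y \<in> diagonal \<Longrightarrow> diag_dist x \<le> dinf x y"
  unfolding diag_dist_def
  by (rule cINF_lower) (auto intro: bdd_belowI2[where m = 0] infnorm_pos_le)

lemma diag_dist_nonneg: "0 \<le> diag_dist x"
  unfolding diag_dist_def
  by (rule cINF_greatest) (auto simp: diagonal_def infnorm_pos_le)

text \<open>The two coordinate distances from \<open>x\<close> to any diagonal point add up to at
  least the distance between the coordinates of \<open>x\<close>. The larger one is therefore at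
  least half of it, and the midpoint attains this value.\<close>

lemma dinf_diag_proj_le: "dinf x (diag_proj x) \<le> diag_dist x"
  unfolding diag_dist_def
proof (rule cINF_greatest)
  fix y assume "y \<in> diagonal"
  then show "dinf x (diag_proj x) \<le> dinf x y"
    unfolding infnorm_real_pair diag_proj_def diagonal_def max_def abs_if
    by (auto split: if_splits simp: field_simps)
qed (auto simp: diagonal_def)

lemma dinf_diag_proj_diag_proj_le: "dinf (diag_proj x) (diag_proj y) \<le> dinf x y"
proof -
  have "\<bar>(a + b) / 2 - (c + d) / 2\<bar> \<le> max \<bar>a - c\<bar> \<bar>b - d\<bar>" for a b c d :: real
    by (simp add: max_def abs_if field_simps)
  then show ?thesis by (simp add: infnorm_real_pair diag_proj_def)
qed

section \<open>Tagged multisets and partial matchings\<close>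

lemma tagged_eq_Sigma: "tagged D = Sigma (set_mset D) (\<lambda>x. {..<count D x})"
  by (auto simp: tagged_def count_greater_zero_iff[symmetric] simp del: count_greater_zero_iff)

lemma finite_tagged [simp]: "finite (tagged D)"
  by (simp add: tagged_eq_Sigma)

lemma tagged_mono: "B \<subseteq># D \<Longrightarrow> tagged B \<subseteq> tagged D"
  by (auto simp: tagged_def subseteq_mset_def intro: order_less_le_trans)

lemma sum_mset_tagged: "(\<Sum>x\<in>#D. F x) = (\<Sum>a\<in>tagged D. F (fst a))" for F :: "'a \<Rightarrow> real"
proof -
  have "(\<Sum>x\<in>#D. F x) = (\<Sum>x\<in>set_mset D. count D x * F x)"
  proof (induction D)
    case (add y D)
    show ?case
    proof (cases "y \<in># D")
      case True
      then show ?thesis using add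
        by (simp add: insert_absorb sum.remove[of _ y] algebra_simps) (intro sum.cong, auto)
    next
      case False
      then show ?thesis using add
        by (simp add: not_in_iff) (intro sum.cong, use False in auto)
    qed
  qed simp
  also have "\<dots> = (\<Sum>x\<in>set_mset D. \<Sum>i<count D x. F x)" by simp
  also have "\<dots> = (\<Sum>a\<in>tagged D. F (fst a))"
    unfolding tagged_eq_Sigma by (subst sum.Sigma) (auto simp: split_def)
  finally show ?thesis .
qed

text \<open>\<open>S\<close> is a copy of \<open>B\<close> inside \<open>tagged D\<close> whose tags
  may differ, with \<open>r\<close> preserving the points. The two differences need not agree in
  their tags, so both sides are obtained by subtracting equal sums from the total over
  \<open>D\<close>.\<close>

lemma sum_mset_diff_tagged:
  fixes F :: "'a \<Rightarrow> real"
  assumes B: "B \<subseteq># D" and S: "S \<subseteq> tagged D"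
    and r: "bij_betw r (tagged B) S" "\<And>a. a \<in> tagged B \<Longrightarrow> fst (r a) = fst a"
  shows "(\<Sum>x\<in>#D - B. F x) = (\<Sum>a\<in>tagged D - S. F (fst a))"
proof -
  have "(\<Sum>x\<in>#D. F x) = (\<Sum>x\<in>#D - B. F x) + (\<Sum>x\<in>#B. F x)"
    using B by (metis image_mset_union subset_mset.diff_add sum_mset.union)
  moreover have "(\<Sum>x\<in>#B. F x) = (\<Sum>a\<in>S. F (fst a))"
    using r by (simp add: sum_mset_tagged sum.reindex_bij_betw[OF r(1), symmetric] cong: sum.cong)
  moreover have "(\<Sum>a\<in>tagged D - S. F (fst a)) = (\<Sum>a\<in>tagged D. F (fst a)) - (\<Sum>a\<in>S. F (fst a))"
    using S by (simp add: sum_diff)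
  ultimately show ?thesis by (simp add: sum_mset_tagged)
qed

text \<open>
  The tags occurring in a subset of \<open>tagged D\<close> need not form initial segments, so the
  subset has to be retagged before it comes from a multiset.
\<close>

lemma exists_retagging:
  assumes S: "S \<subseteq> tagged D"
  shows "\<exists>B r. B \<subseteq># D \<and> bij_betw r (tagged B) S \<and> (\<forall>a\<in>tagged B. fst (r a) = fst a)"
proof -
  have finS: "finite S" using S finite_subset by fastforce
  define fib where "fib x = {a \<in> S. fst a = x}" for x
  have fin: "finite (fib x)" for x using finS by (simp add: fib_def)
  define B where "B = image_mset fst (mset_set S)"
  have count: "count B x = card (fib x)" for x
  proof -
    have "fst -` {x} \<inter> S = fib x" by (auto simp: fib_def)
    moreover have "sum (count (mset_set S)) (fib x) = (\<Sum>a\<in>fib x. 1)"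
      using finS by (intro sum.cong) (auto simp: fib_def)
    ultimately show ?thesis using finS by (simp add: B_def count_image_mset)
  qed
  have "card (fib x) \<le> count D x" for x
  proof -
    have "fib x \<subseteq> Pair x ` {..<count D x}" using S by (auto simp: fib_def tagged_def)
    then have "card (fib x) \<le> card (Pair x ` {..<count D x})" by (intro card_mono) auto
    also have "\<dots> = count D x" by (simp add: card_image inj_on_def)
    finally show ?thesis .
  qed
  then have sub: "B \<subseteq># D" by (simp add: subseteq_mset_def count)
  \<comment> \<open>The fibre of \<open>S\<close> over \<open>x\<close> is renumbered by
    \<open>0, ..., count B x - 1\<close>, closing the gaps in its tags.\<close>
  have "\<forall>x. \<exists>e. bij_betw e {0..<count B x} (fib x)"
    using ex_bij_betw_nat_finite[OF fin] by (simp add: count)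
  then obtain e where e: "\<And>x. bij_betw (e x) {0..<count B x} (fib x)" by metis
  have fst_e: "e x i \<in> S" "fst (e x i) = x" if "i < count B x" for x i
    using bij_betwE[OF e[of x]] that by (auto simp: fib_def)
  define r where "r a = e (fst a) (snd a)" for a
  have fst_r: "fst (r a) = fst a" if "a \<in> tagged B" for a
    using fst_e(2)[of "snd a" "fst a"] that by (auto simp: r_def tagged_def)
  have "inj_on r (tagged B)"
  proof (rule inj_onI)
    fix a b assume *: "a \<in> tagged B" "b \<in> tagged B" "r a = r b"
    have fst_eq: "fst a = fst b" using fst_r[OF *(1)] fst_r[OF *(2)] *(3) by simp
    have "snd a = snd b"
      using * fst_eq e[of "fst a"] by (auto simp: r_def tagged_def bij_betw_def dest: inj_onD)
    then show "a = b" using fst_eq by (simp add: prod_eq_iff)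
  qed
  moreover have "r ` tagged B = S"
  proof
    show "r ` tagged B \<subseteq> S" using fst_e by (auto simp: r_def tagged_def)
    show "S \<subseteq> r ` tagged B"
    proof
      fix a assume "a \<in> S"
      then have "a \<in> e (fst a) ` {0..<count B (fst a)}"
        using e[of "fst a"] by (simp add: bij_betw_def fib_def)
      then obtain i where "i < count B (fst a)" "a = e (fst a) i" by auto
      then show "a \<in> r ` tagged B"
        by (intro image_eqI[of _ _ "(fst a, i)"]) (auto simp: r_def tagged_def)
    qed
  qed
  ultimately have "bij_betw r (tagged B) S" by (simp add: bij_betw_def)
  then show ?thesis using sub fst_r by blast
qed

lemma matching_cost_nonneg: "0 \<le> matching_cost p D E m"
  by (cases m) simp

lemma partial_matchings_nonempty: "partial_matchings D E \<noteq> {}"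
proof -
  have "({#}, {#}, id) \<in> partial_matchings D E" by (simp add: partial_matchings_def tagged_def)
  then show ?thesis by blast
qed

lemma wasserstein_diagram_nonneg: "0 \<le> wasserstein_diagram p D E"
  unfolding wasserstein_diagram_def
  by (intro cINF_greatest partial_matchings_nonempty matching_cost_nonneg)

text \<open>Matchings may thus be given by bijections between arbitrary sets of tagged points.
  Composing \<open>\<phi>\<close> with the retaggings of \<open>S\<close> and \<open>S'\<close>
  yields a genuine partial matching, and since retagging keeps the points, its cost is exactly the
  right-hand side.\<close>

lemma wasserstein_diagram_le:
  assumes S: "S \<subseteq> tagged D" and S': "S' \<subseteq> tagged E" and \<phi>: "bij_betw \<phi> S S'"
  shows "wasserstein_diagram p D E \<le>
    ((\<Sum>a\<in>S. dinf (fst a) (fst (\<phi> a)) powr p)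
      + (\<Sum>a\<in>tagged D - S. diag_dist (fst a) powr p)
      + (\<Sum>a\<in>tagged E - S'. diag_dist (fst a) powr p)) powr (1 / p)"
proof -
  obtain B1 r1 where 1: "B1 \<subseteq># D" "bij_betw r1 (tagged B1) S" "\<And>a. a \<in> tagged B1 \<Longrightarrow> fst (r1 a) = fst a"
    using exists_retagging[OF S] by blast
  obtain B2 r2 where 2: "B2 \<subseteq># E" "bij_betw r2 (tagged B2) S'" "\<And>a. a \<in> tagged B2 \<Longrightarrow> fst (r2 a) = fst a"
    using exists_retagging[OF S'] by blast
  define f where "f = inv_into (tagged B2) r2 \<circ> (\<phi> \<circ> r1)"
  have f: "bij_betw f (tagged B1) (tagged B2)"
    unfolding f_def by (intro bij_betw_trans[OF bij_betw_trans[OF 1(2) \<phi>]] bij_betw_inv_into 2(2))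
  have fst_f: "fst (f a) = fst (\<phi> (r1 a))" if a: "a \<in> tagged B1" for a
  proof -
    have "\<phi> (r1 a) \<in> S'" using a 1(2) \<phi> bij_betwE by metis
    then have "r2 (f a) = \<phi> (r1 a)" using 2(2) by (simp add: f_def bij_betw_inv_into_right)
    moreover have "f a \<in> tagged B2" using f a bij_betwE by metis
    ultimately show ?thesis using 2(3) by metis
  qed
  have "(\<Sum>a\<in>tagged B1. dinf (fst a) (fst (f a)) powr p)
      = (\<Sum>a\<in>tagged B1. dinf (fst (r1 a)) (fst (\<phi> (r1 a))) powr p)"
    using 1(3) fst_f by (intro sum.cong) auto
  also have "\<dots> = (\<Sum>a\<in>S. dinf (fst a) (fst (\<phi> a)) powr p)"
    by (rule sum.reindex_bij_betw[OF 1(2)])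
  finally have "matching_cost p D E (B1, B2, f) =
    ((\<Sum>a\<in>S. dinf (fst a) (fst (\<phi> a)) powr p)
      + (\<Sum>a\<in>tagged D - S. diag_dist (fst a) powr p)
      + (\<Sum>a\<in>tagged E - S'. diag_dist (fst a) powr p)) powr (1 / p)"
    by (simp add: sum_mset_diff_tagged[OF 1(1) S 1(2,3)] sum_mset_diff_tagged[OF 2(1) S' 2(2,3)])
  moreover have "(B1, B2, f) \<in> partial_matchings D E"
    using 1(1) 2(1) f by (simp add: partial_matchings_def)
  ultimately show ?thesis
    unfolding wasserstein_diagram_def
    by (metis (no_types, lifting) cINF_lower bdd_belowI2 matching_cost_nonneg)
qed

section \<open>Wasserstein distance between uniform measures\<close>

lemma wasserstein_measure_uniform_image_le:
  assumes p: "0 < p" and T: "finite T" "T \<noteq> {}" and \<sigma>: "bij_betw \<sigma> T T"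
  shows "wasserstein_measure p (uniform_image T g) (uniform_image T h)
    \<le> ((\<Sum>t\<in>T. dinf (g t) (h (\<sigma> t)) powr p) / card T) powr (1 / p)"
proof -
  obtain \<gamma> where \<gamma>: "\<gamma> \<in> couplings (uniform_image T g) (uniform_image T h)"
    "(\<integral>\<^sup>+ z. ennreal (dinf (fst z) (snd z) powr p) \<partial>\<gamma>)
      = ennreal ((\<Sum>t\<in>T. dinf (g t) (h (\<sigma> t)) powr p) / card T)"
    using uniform_image_coupling[OF T \<sigma>] by blast
  have "(INF \<gamma>\<in>couplings (uniform_image T g) (uniform_image T h).
      \<integral>\<^sup>+ z. ennreal (dinf (fst z) (snd z) powr p) \<partial>\<gamma>)
      \<le> ennreal ((\<Sum>t\<in>T. dinf (g t) (h (\<sigma> t)) powr p) / card T)"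
    using \<gamma> by (metis (no_types, lifting) INF_lower)
  then show ?thesis
    unfolding wasserstein_measure_def using p
    by (intro powr_mono2 enn2real_leI) (auto intro!: divide_nonneg_nonneg sum_nonneg)
qed

text \<open>Every coupling costs at least as much as some bijection, so the infimum of the integrals
  is at least \<open>w powr p\<close>; the root is taken only after conversion to a real
  number.\<close>

lemma le_wasserstein_measure_uniform_image:
  assumes p: "0 < p" and T: "finite T" "T \<noteq> {}" and w: "0 \<le> w"
    and le: "\<And>\<sigma>. bij_betw \<sigma> T T \<Longrightarrow>
      w \<le> ((\<Sum>t\<in>T. dinf (g t) (h (\<sigma> t)) powr p) / card T) powr (1 / p)"
  shows "w \<le> wasserstein_measure p (uniform_image T g) (uniform_image T h)"
proof -
  let ?I = "INF \<gamma>\<in>couplings (uniform_image T g) (uniform_image T h).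
      \<integral>\<^sup>+ z. ennreal (dinf (fst z) (snd z) powr p) \<partial>\<gamma>"
  have "ennreal (w powr p) \<le> ?I"
  proof (rule INF_greatest)
    fix \<gamma> assume "\<gamma> \<in> couplings (uniform_image T g) (uniform_image T h)"
    then obtain \<sigma> where \<sigma>: "bij_betw \<sigma> T T"
      "ennreal ((\<Sum>t\<in>T. dinf (g t) (h (\<sigma> t)) powr p) / card T)
        \<le> (\<integral>\<^sup>+ z. ennreal (dinf (fst z) (snd z) powr p) \<partial>\<gamma>)"
      using exists_permutation_le_coupling[OF T] by blast
    have "w powr p \<le> (((\<Sum>t\<in>T. dinf (g t) (h (\<sigma> t)) powr p) / card T) powr (1 / p)) powr p"
      using le[OF \<sigma>(1)] w p by (intro powr_mono2) auto
    also have "\<dots> = (\<Sum>t\<in>T. dinf (g t) (h (\<sigma> t)) powr p) / card T"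
      using p by (simp add: powr_powr sum_nonneg)
    finally show "ennreal (w powr p) \<le> (\<integral>\<^sup>+ z. ennreal (dinf (fst z) (snd z) powr p) \<partial>\<gamma>)"
      using \<sigma>(2) by (meson ennreal_leI order_trans)
  qed
  \<comment> \<open>\<open>enn2real\<close> sends infinity to \<open>0\<close> and is monotone only
    below it; the coupling induced by the identity shows that the infimum is finite.\<close>
  moreover have "?I < \<top>"
  proof -
    obtain \<gamma> where "\<gamma> \<in> couplings (uniform_image T g) (uniform_image T h)"
      "(\<integral>\<^sup>+ z. ennreal (dinf (fst z) (snd z) powr p) \<partial>\<gamma>)
        = ennreal ((\<Sum>t\<in>T. dinf (g t) (h (id t)) powr p) / card T)"
      using uniform_image_coupling[OF T bij_betw_id] by blast
    then have "?I \<le> ennreal ((\<Sum>t\<in>T. dinf (g t) (h (id t)) powr p) / card T)"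
      by (metis (no_types, lifting) INF_lower)
    then show ?thesis using ennreal_less_top order_le_less_trans by blast
  qed
  ultimately have "w powr p \<le> enn2real ?I"
    using enn2real_mono[of "ennreal (w powr p)" ?I] by simp
  then have "(w powr p) powr (1 / p) \<le> enn2real ?I powr (1 / p)"
    using p by (intro powr_mono2) auto
  then show ?thesis
    unfolding wasserstein_measure_def using p w by (simp add: powr_powr)
qed

section \<open>Permutations of the common index set versus partial matchings\<close>

text \<open>
  \<open>t = (F, x, i)\<close> ranges over the index set \<open>Sigma \<D> tagged\<close>, which is the same for all
  \<open>D\<close> in \<open>\<D>\<close>.
\<close>

definition place ::
  "(real \<times> real) multiset \<Rightarrow> (real \<times> real) multiset \<times> (real \<times> real) \<times> nat \<Rightarrow> real \<times> real" where
  "place D t = (if fst t = D then fst (snd t) else diag_proj (fst (snd t)))"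

text \<open>Points of \<open>D\<close> sent to points of \<open>E\<close> become matched pairs. Any
  other point of \<open>D\<close> is sent to a diagonal point, and any other point of
  \<open>E\<close> is hit by one, so these terms dominate the distances to the diagonal. The three
  groups use disjoint indices, and the remaining terms are nonnegative.\<close>

lemma wasserstein_diagram_le_permutation:
  assumes p: "0 < p" and fin: "finite \<D>" and D: "D \<in> \<D>" and E: "E \<in> \<D>" and ne: "D \<noteq> E"
    and \<sigma>: "bij_betw \<sigma> (Sigma \<D> tagged) (Sigma \<D> tagged)"
  shows "wasserstein_diagram p D E
    \<le> (\<Sum>t\<in>Sigma \<D> tagged. dinf (place D t) (place E (\<sigma> t)) powr p) powr (1 / p)"
proof -
  let ?T = "Sigma \<D> tagged"
  define k where "k t = dinf (place D t) (place E (\<sigma> t)) powr p" for t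
  have finT: "finite ?T" using fin by simp
  define S where "S = {a \<in> tagged D. fst (\<sigma> (D, a)) = E}"
  define \<phi> where "\<phi> a = snd (\<sigma> (D, a))" for a
  define \<tau> where "\<tau> = inv_into ?T \<sigma>"
  have \<sigma>T: "\<sigma> t \<in> ?T" if "t \<in> ?T" for t using \<sigma> that bij_betwE by blast
  have \<tau>T: "\<tau> t \<in> ?T" and \<sigma>\<tau>: "\<sigma> (\<tau> t) = t" if "t \<in> ?T" for t
    using \<sigma> that bij_betw_inv_into bij_betwE unfolding \<tau>_def
    by (blast, simp add: bij_betw_inv_into_right)
  have \<sigma>S: "\<sigma> (D, a) = (E, \<phi> a)" if "a \<in> S" for a
    using that by (simp add: S_def \<phi>_def prod_eq_iff)
  have inj: "inj_on \<phi> S"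
  proof (rule inj_onI)
    fix a b assume *: "a \<in> S" "b \<in> S" "\<phi> a = \<phi> b"
    then have "\<sigma> (D, a) = \<sigma> (D, b)" using \<sigma>S by simp
    then show "a = b" using * \<sigma> D by (auto simp: S_def bij_betw_def dest: inj_onD)
  qed
  have \<phi>E: "\<phi> ` S \<subseteq> tagged E"
  proof
    fix b assume "b \<in> \<phi> ` S"
    then obtain a where a: "a \<in> S" "b = \<phi> a" by blast
    then have "\<sigma> (D, a) \<in> ?T" using D by (intro \<sigma>T) (auto simp: S_def)
    then show "b \<in> tagged E" using \<sigma>S[OF a(1)] a(2) by simp
  qed
  \<comment> \<open>The preimage of an unmatched point of \<open>E\<close> lies outside the block of
    \<open>D\<close>. There \<open>place D\<close> lands on the diagonal, and disjointness from the
    indices of \<open>D\<close> follows.\<close>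
  have fst_\<tau>: "fst (\<tau> (E, b)) \<noteq> D" if b: "b \<in> tagged E - \<phi> ` S" for b
  proof
    assume "fst (\<tau> (E, b)) = D"
    then obtain a where a: "\<tau> (E, b) = (D, a)" by (metis prod.collapse)
    then have "a \<in> tagged D" "\<sigma> (D, a) = (E, b)"
      using \<tau>T[of "(E, b)"] \<sigma>\<tau>[of "(E, b)"] b E by auto
    then have "a \<in> S" "\<phi> a = b" by (auto simp: S_def \<phi>_def)
    then show False using b by blast
  qed
  let ?X = "Pair D ` S" and ?Y = "Pair D ` (tagged D - S)"
  \<comment> \<open>The cost is summed over sources, so the unmatched points of \<open>E\<close> are
    pulled back along \<open>\<tau>\<close>.\<close>
  let ?Z = "\<tau> ` (Pair E ` (tagged E - \<phi> ` S))"
  have "?Z \<subseteq> ?T" using E by (intro image_subsetI \<tau>T) auto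
  then have sub: "?X \<union> ?Y \<union> ?Z \<subseteq> ?T" using D by (auto simp: S_def)
  have finS: "finite S" by (rule finite_subset[OF _ finite_tagged[of D]]) (auto simp: S_def)
  have "(\<Sum>a\<in>S. dinf (fst a) (fst (\<phi> a)) powr p) = sum k ?X"
    using ne by (subst sum.reindex) (auto simp: inj_on_def k_def place_def \<sigma>S intro!: sum.cong)
  moreover have "(\<Sum>a\<in>tagged D - S. diag_dist (fst a) powr p) \<le> sum k ?Y"
  proof -
    have "diag_dist (fst a) powr p \<le> k (D, a)" if a: "a \<in> tagged D - S" for a
    proof -
      have "fst (\<sigma> (D, a)) \<noteq> E" using a by (auto simp: S_def)
      then have "diag_dist (fst a) \<le> dinf (place D (D, a)) (place E (\<sigma> (D, a)))"
        by (simp add: place_def diag_dist_le)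
      then show ?thesis unfolding k_def using p by (intro powr_mono2 diag_dist_nonneg) auto
    qed
    then show ?thesis by (subst sum.reindex) (auto simp: inj_on_def intro: sum_mono)
  qed
  moreover have "(\<Sum>b\<in>tagged E - \<phi> ` S. diag_dist (fst b) powr p) \<le> sum k ?Z"
  proof -
    have "diag_dist (fst b) powr p \<le> k (\<tau> (E, b))" if b: "b \<in> tagged E - \<phi> ` S" for b
    proof -
      have "\<sigma> (\<tau> (E, b)) = (E, b)" using b E by (intro \<sigma>\<tau>) auto
      then have "diag_dist (fst b) \<le> dinf (place D (\<tau> (E, b))) (place E (\<sigma> (\<tau> (E, b))))"
        using fst_\<tau>[OF b] by (subst dinf_sym) (simp add: place_def diag_dist_le)
      then show ?thesis unfolding k_def using p by (intro powr_mono2 diag_dist_nonneg) auto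
    qed
    moreover have "inj_on (\<lambda>b. \<tau> (E, b)) (tagged E - \<phi> ` S)"
    proof (rule inj_onI)
      fix b c assume *: "b \<in> tagged E - \<phi> ` S" "c \<in> tagged E - \<phi> ` S" "\<tau> (E, b) = \<tau> (E, c)"
      have "(E, b) = \<sigma> (\<tau> (E, b))" using *(1) E by (intro \<sigma>\<tau>[symmetric]) auto
      also have "\<dots> = (E, c)" unfolding *(3) using *(2) E by (intro \<sigma>\<tau>) auto
      finally show "b = c" by simp
    qed
    ultimately show ?thesis
      unfolding image_image by (subst sum.reindex) (auto intro: sum_mono)
  qed
  moreover have "sum k ?X + sum k ?Y + sum k ?Z = sum k (?X \<union> ?Y \<union> ?Z)"
  proof -
    have "\<forall>t\<in>?X \<union> ?Y. fst t = D" by auto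
    moreover have "\<forall>t\<in>?Z. fst t \<noteq> D" using fst_\<tau> by blast
    ultimately have "(?X \<union> ?Y) \<inter> ?Z = {}" by blast
    then have "sum k (?X \<union> ?Y \<union> ?Z) = sum k (?X \<union> ?Y) + sum k ?Z"
      using finS by (intro sum.union_disjoint) simp_all
    also have "sum k (?X \<union> ?Y) = sum k ?X + sum k ?Y"
      using finS by (intro sum.union_disjoint) auto
    finally show ?thesis by simp
  qed
  moreover have "sum k (?X \<union> ?Y \<union> ?Z) \<le> sum k ?T"
    by (rule sum_mono2[OF finT sub]) (simp add: k_def)
  ultimately have le: "(\<Sum>a\<in>S. dinf (fst a) (fst (\<phi> a)) powr p)
      + (\<Sum>a\<in>tagged D - S. diag_dist (fst a) powr p)
      + (\<Sum>a\<in>tagged E - \<phi> ` S. diag_dist (fst a) powr p) \<le> sum k ?T" by linarith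
  have "wasserstein_diagram p D E \<le> ((\<Sum>a\<in>S. dinf (fst a) (fst (\<phi> a)) powr p)
      + (\<Sum>a\<in>tagged D - S. diag_dist (fst a) powr p)
      + (\<Sum>a\<in>tagged E - \<phi> ` S. diag_dist (fst a) powr p)) powr (1 / p)"
    using inj \<phi>E by (intro wasserstein_diagram_le) (auto simp: S_def bij_betw_def)
  also have "\<dots> \<le> sum k ?T powr (1 / p)"
    using le p by (intro powr_mono2) (auto intro!: add_nonneg_nonneg sum_nonneg)
  finally show ?thesis unfolding k_def .
qed

text \<open>
  Swapping every matched pair costs \<open>d(x, f x)\<close> once between the points themselves and at
  most once more between their projections; this is the source of the factor \<open>2\<close>.
\<close>

lemma exists_permutation_le_matching:
  assumes p: "0 < p" and fin: "finite \<D>" and D: "D \<in> \<D>" and E: "E \<in> \<D>" and ne: "D \<noteq> E"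
    and m: "m \<in> partial_matchings D E"
  shows "\<exists>\<sigma>. bij_betw \<sigma> (Sigma \<D> tagged) (Sigma \<D> tagged) \<and>
    (\<Sum>t\<in>Sigma \<D> tagged. dinf (place D t) (place E (\<sigma> t)) powr p) powr (1 / p)
      \<le> 2 powr (1 / p) * matching_cost p D E m"
proof -
  let ?T = "Sigma \<D> tagged"
  obtain B1 B2 f where m_eq: "m = (B1, B2, f)" and B1: "B1 \<subseteq># D" and B2: "B2 \<subseteq># E"
    and f: "bij_betw f (tagged B1) (tagged B2)"
    using m by (auto simp: partial_matchings_def)
  define f' where "f' = inv_into (tagged B1) f"
  have f': "bij_betw f' (tagged B2) (tagged B1)" using f by (simp add: f'_def bij_betw_inv_into)
  have ff': "f (f' b) = b" "f' b \<in> tagged B1" if "b \<in> tagged B2" for b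
    using f f' that bij_betwE by (auto simp: f'_def bij_betw_inv_into_right)
  have f'f: "f' (f a) = a" "f a \<in> tagged B2" if "a \<in> tagged B1" for a
    using f that bij_betwE by (auto simp: f'_def bij_betw_inv_into_left)
  have s1: "tagged B1 \<subseteq> tagged D" and s2: "tagged B2 \<subseteq> tagged E"
    using B1 B2 by (simp_all add: tagged_mono)
  \<comment> \<open>An involution: matched indices of \<open>D\<close> and \<open>E\<close> are
    exchanged and all others stay fixed. A fixed index of \<open>D\<close> or \<open>E\<close> pairs
    its point with its own projection, because only one of \<open>place D\<close> and
    \<open>place E\<close> projects it.\<close>
  define \<sigma> where "\<sigma> t = (if fst t = D \<and> snd t \<in> tagged B1 then (E, f (snd t))
      else if fst t = E \<and> snd t \<in> tagged B2 then (D, f' (snd t)) else t)" for t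
  have \<sigma>T: "\<sigma> t \<in> ?T" if "t \<in> ?T" for t
    using that D E s1 s2 ff' f'f by (auto simp: \<sigma>_def)
  have \<sigma>\<sigma>: "\<sigma> (\<sigma> t) = t" for t
    using ne ff' f'f by (cases t) (auto simp: \<sigma>_def)
  have bij: "bij_betw \<sigma> ?T ?T"
    using \<sigma>\<sigma> by (intro bij_betw_byWitness[of _ \<sigma>] image_subsetI \<sigma>T) auto
  define k where "k t = dinf (place D t) (place E (\<sigma> t)) powr p" for t
  let ?S = "\<Sum>a\<in>tagged B1. dinf (fst a) (fst (f a)) powr p"
  let ?X1 = "Pair D ` tagged B1" and ?X2 = "Pair E ` tagged B2"
  let ?Y1 = "Pair D ` (tagged D - tagged B1)" and ?Y2 = "Pair E ` (tagged E - tagged B2)"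
  have "sum k ?T = sum k ((?X1 \<union> ?X2) \<union> (?Y1 \<union> ?Y2))"
  proof (rule sum.mono_neutral_right)
    show "finite ?T" using fin by simp
    show "(?X1 \<union> ?X2) \<union> (?Y1 \<union> ?Y2) \<subseteq> ?T" using D E s1 s2 by auto
    \<comment> \<open>Both placements project the indices of any third diagram, and
      \<open>\<sigma>\<close> fixes them, so they cost nothing.\<close>
    show "\<forall>t\<in>?T - ((?X1 \<union> ?X2) \<union> (?Y1 \<union> ?Y2)). k t = 0"
    proof
      fix t assume t: "t \<in> ?T - ((?X1 \<union> ?X2) \<union> (?Y1 \<union> ?Y2))"
      obtain F a where "t = (F, a)" by (cases t)
      then have "fst t \<noteq> D" "fst t \<noteq> E" using t by auto
      then show "k t = 0" by (simp add: k_def \<sigma>_def place_def infnorm_0)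
    qed
  qed
  also have "\<dots> = (sum k ?X1 + sum k ?X2) + (sum k ?Y1 + sum k ?Y2)"
  proof -
    have "sum k ((?X1 \<union> ?X2) \<union> (?Y1 \<union> ?Y2)) = sum k (?X1 \<union> ?X2) + sum k (?Y1 \<union> ?Y2)"
      using ne by (intro sum.union_disjoint) auto
    also have "sum k (?X1 \<union> ?X2) = sum k ?X1 + sum k ?X2"
      using ne by (intro sum.union_disjoint) auto
    also have "sum k (?Y1 \<union> ?Y2) = sum k ?Y1 + sum k ?Y2"
      using ne by (intro sum.union_disjoint) auto
    finally show ?thesis .
  qed
  also have "sum k ?X1 = ?S"
    using ne by (subst sum.reindex) (auto simp: inj_on_def k_def place_def \<sigma>_def intro!: sum.cong)
  also have "sum k ?X2 \<le> ?S"
  proof -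
    have "sum k ?X2 = (\<Sum>b\<in>tagged B2. k (E, b))"
      by (subst sum.reindex) (auto simp: inj_on_def)
    also have "\<dots> \<le> (\<Sum>b\<in>tagged B2. dinf (fst (f' b)) (fst (f (f' b))) powr p)"
    proof (rule sum_mono)
      fix b assume b: "b \<in> tagged B2"
      \<comment> \<open>The index \<open>(E, b)\<close> is sent to \<open>(D, f' b)\<close>. Here
        \<open>place D\<close> sees the block of \<open>E\<close> and \<open>place E\<close> the
        block of \<open>D\<close>, so both points are projected.\<close>
      have "k (E, b) = dinf (diag_proj (fst b)) (diag_proj (fst (f' b))) powr p"
        using b ne by (simp add: k_def place_def \<sigma>_def)
      also have "\<dots> \<le> dinf (fst b) (fst (f' b)) powr p"
        using p by (intro powr_mono2 dinf_diag_proj_diag_proj_le infnorm_pos_le) auto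
      also have "\<dots> = dinf (fst (f' b)) (fst (f (f' b))) powr p"
        using b by (simp add: ff' dinf_sym)
      finally show "k (E, b) \<le> dinf (fst (f' b)) (fst (f (f' b))) powr p" .
    qed
    also have "\<dots> = ?S" by (rule sum.reindex_bij_betw[OF f'])
    finally show ?thesis .
  qed
  also have "sum k ?Y1 \<le> (\<Sum>x\<in>#D - B1. diag_dist x powr p)"
  proof -
    have "sum k ?Y1 = (\<Sum>a\<in>tagged D - tagged B1. k (D, a))"
      by (subst sum.reindex) (auto simp: inj_on_def)
    also have "\<dots> \<le> (\<Sum>a\<in>tagged D - tagged B1. diag_dist (fst a) powr p)"
    proof (rule sum_mono)
      fix a assume "a \<in> tagged D - tagged B1"
      then have "k (D, a) = dinf (fst a) (diag_proj (fst a)) powr p"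
        using ne by (simp add: k_def place_def \<sigma>_def)
      also have "\<dots> \<le> diag_dist (fst a) powr p"
        using p by (intro powr_mono2 dinf_diag_proj_le infnorm_pos_le) auto
      finally show "k (D, a) \<le> diag_dist (fst a) powr p" .
    qed
    also have "\<dots> = (\<Sum>x\<in>#D - B1. diag_dist x powr p)"
      by (rule sum_mset_diff_tagged[OF B1 s1 bij_betw_id, symmetric]) simp
    finally show ?thesis .
  qed
  also have "sum k ?Y2 \<le> (\<Sum>x\<in>#E - B2. diag_dist x powr p)"
  proof -
    have "sum k ?Y2 = (\<Sum>a\<in>tagged E - tagged B2. k (E, a))"
      by (subst sum.reindex) (auto simp: inj_on_def)
    also have "\<dots> \<le> (\<Sum>a\<in>tagged E - tagged B2. diag_dist (fst a) powr p)"
    proof (rule sum_mono)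
      fix a assume "a \<in> tagged E - tagged B2"
      then have "k (E, a) = dinf (fst a) (diag_proj (fst a)) powr p"
        using ne by (auto simp: k_def place_def \<sigma>_def dinf_sym)
      also have "\<dots> \<le> diag_dist (fst a) powr p"
        using p by (intro powr_mono2 dinf_diag_proj_le infnorm_pos_le) auto
      finally show "k (E, a) \<le> diag_dist (fst a) powr p" .
    qed
    also have "\<dots> = (\<Sum>x\<in>#E - B2. diag_dist x powr p)"
      by (rule sum_mset_diff_tagged[OF B2 s2 bij_betw_id, symmetric]) simp
    finally show ?thesis .
  qed
  finally have "sum k ?T \<le> (?S + ?S)
      + ((\<Sum>x\<in>#D - B1. diag_dist x powr p) + (\<Sum>x\<in>#E - B2. diag_dist x powr p))"
    by simp
  \<comment> \<open>The unmatched terms occur only once; being nonnegative, they may be doubled as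
    well, so that the factor 2 applies to the whole cost.\<close>
  moreover have "0 \<le> (\<Sum>x\<in>#F. diag_dist x powr p)" for F
    by (simp add: sum_mset_tagged sum_nonneg)
  ultimately have le: "sum k ?T \<le> 2 * (?S + (\<Sum>x\<in>#D - B1. diag_dist x powr p)
      + (\<Sum>x\<in>#E - B2. diag_dist x powr p))"
    (is "_ \<le> 2 * ?C")
    by (smt (verit))
  have "sum k ?T powr (1 / p) \<le> (2 * ?C) powr (1 / p)"
    using le p by (intro powr_mono2) (auto simp: k_def intro: sum_nonneg)
  also have "\<dots> = 2 powr (1 / p) * matching_cost p D E m"
    by (simp add: m_eq powr_mult del: distrib_left_numeral)
  finally show ?thesis using bij unfolding k_def by blast
qed

section \<open>The embedding and its distortion\<close>

definition diagram_measure ::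
  "real \<Rightarrow> (real \<times> real) multiset set \<Rightarrow> (real \<times> real) multiset \<Rightarrow> (real \<times> real) measure" where
  "diagram_measure p \<D> D = uniform_image (Sigma \<D> tagged)
     (\<lambda>t. card (Sigma \<D> tagged) powr (1 / p) *\<^sub>R place D t)"

lemma scaled_cost:
  assumes "0 < p" "finite T" "T \<noteq> {}"
  shows "(\<Sum>t\<in>T. dinf (card T powr (1 / p) *\<^sub>R g t) (card T powr (1 / p) *\<^sub>R h t) powr p) / card T
    = (\<Sum>t\<in>T. dinf (g t) (h t) powr p)"
proof -
  have "dinf (card T powr (1 / p) *\<^sub>R g t) (card T powr (1 / p) *\<^sub>R h t) powr p
      = card T * dinf (g t) (h t) powr p" for t
    using assms by (simp add: scaleR_diff_right[symmetric] infnorm_mul powr_mult infnorm_pos_le powr_powr)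
  then show ?thesis using assms by (simp add: sum_distrib_left[symmetric])
qed

text \<open>A diagram can be read off from its measure. Projected points stay on the diagonal after
  scaling, so the atom at the scaled copy of a point \<open>x\<close> above the diagonal comes only
  from the block of \<open>D\<close> and has mass
  \<open>count D x / card (Sigma \<D> tagged)\<close>.\<close>

lemma inj_on_diagram_measure:
  assumes fin: "finite \<D>" and ne: "Sigma \<D> tagged \<noteq> {}" and sub: "\<D> \<subseteq> diagrams"
  shows "inj_on (diagram_measure p \<D>) \<D>"
proof (rule inj_onI)
  let ?T = "Sigma \<D> tagged"
  let ?c = "card ?T powr (1 / p)"
  have finT: "finite ?T" using fin by simp
  then have M: "0 < card ?T" using ne by (simp add: card_gt_0_iff)
  have count: "count D x = card ?T * measure (diagram_measure p \<D> D) {?c *\<^sub>R x}"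
    if D: "D \<in> \<D>" and x: "fst x < snd x" for D x
  proof -
    have "{t \<in> ?T. ?c *\<^sub>R place D t \<in> {?c *\<^sub>R x}} = {t \<in> ?T. place D t = x}" using M by auto
    also have "\<dots> = (\<lambda>i. (D, x, i)) ` {..<count D x}"
      using D x by (auto simp: place_def diag_proj_def tagged_def split: if_splits)
    finally have "card {t \<in> ?T. ?c *\<^sub>R place D t \<in> {?c *\<^sub>R x}} = count D x"
      by (simp add: card_image inj_on_def)
    then show ?thesis
      using M unfolding diagram_measure_def by (subst measure_uniform_image[OF finT ne]) auto
  qed
  fix D E assume DE: "D \<in> \<D>" "E \<in> \<D>" "diagram_measure p \<D> D = diagram_measure p \<D> E"
  show "D = E"
  proof (rule multiset_eqI)
    fix x
    show "count D x = count E x"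
    proof (cases "fst x < snd x")
      case True
      then have "real (count D x) = real (count E x)" using count DE by simp
      then show ?thesis by simp
    next
      case False
      then have "x \<notin> {(b, d). b < d}" by auto
      then have "x \<notin># D" "x \<notin># E" using DE(1,2) sub unfolding diagrams_def by (blast, blast)
      then show ?thesis by (simp add: not_in_iff)
    qed
  qed
qed

lemma wasserstein_diagram_refl: "wasserstein_diagram p D D = 0"
proof -
  have "wasserstein_diagram p D D \<le> 0"
    using wasserstein_diagram_le[of "tagged D" D "tagged D" D id p] by (simp add: infnorm_0)
  then show ?thesis using wasserstein_diagram_nonneg[of p D D] by simp
qed

lemma wasserstein_diagram_le_measure:
  assumes p: "0 < p" and fin: "finite \<D>" and ne: "Sigma \<D> tagged \<noteq> {}"
    and D: "D \<in> \<D>" and E: "E \<in> \<D>"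
  shows "wasserstein_diagram p D E \<le> wasserstein_measure p (diagram_measure p \<D> D) (diagram_measure p \<D> E)"
proof (cases "D = E")
  case True
  then show ?thesis by (simp add: wasserstein_diagram_refl wasserstein_measure_def)
next
  case False
  have finT: "finite (Sigma \<D> tagged)" using fin by simp
  show ?thesis
    unfolding diagram_measure_def
    by (rule le_wasserstein_measure_uniform_image[OF p finT ne wasserstein_diagram_nonneg])
      (simp only: scaled_cost[OF p finT ne] wasserstein_diagram_le_permutation[OF p fin D E False])
qed

lemma wasserstein_measure_le_diagram:
  assumes p: "0 < p" and fin: "finite \<D>" and ne: "Sigma \<D> tagged \<noteq> {}"
    and D: "D \<in> \<D>" and E: "E \<in> \<D>"
  shows "wasserstein_measure p (diagram_measure p \<D> D) (diagram_measure p \<D> E)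
    \<le> 2 powr (1 / p) * wasserstein_diagram p D E"
proof -
  let ?T = "Sigma \<D> tagged"
  let ?W = "wasserstein_measure p (diagram_measure p \<D> D) (diagram_measure p \<D> E)"
  have finT: "finite ?T" using fin by simp
  have W: "?W \<le> (\<Sum>t\<in>?T. dinf (place D t) (place E (\<sigma> t)) powr p) powr (1 / p)"
    if "bij_betw \<sigma> ?T ?T" for \<sigma>
    unfolding diagram_measure_def
    by (rule order_trans[OF wasserstein_measure_uniform_image_le[OF p finT ne that]])
      (simp only: scaled_cost[OF p finT ne] order_refl)
  show ?thesis
  proof (cases "D = E")
    case True
    then show ?thesis using W[OF bij_betw_id] by (simp add: wasserstein_diagram_refl infnorm_0)
  next
    case False
    \<comment> \<open>The constant is moved to the left so that the bound passes to the infimum over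
      matchings.\<close>
    have "?W / 2 powr (1 / p) \<le> matching_cost p D E m" if "m \<in> partial_matchings D E" for m
    proof -
      have "?W \<le> 2 powr (1 / p) * matching_cost p D E m"
        using exists_permutation_le_matching[OF p fin D E False that] W by (meson order_trans)
      then show ?thesis by (simp add: field_simps)
    qed
    then have "?W / 2 powr (1 / p) \<le> wasserstein_diagram p D E"
      unfolding wasserstein_diagram_def by (intro cINF_greatest partial_matchings_nonempty)
    then show ?thesis by (simp add: field_simps)
  qed
qed

theorem proposition20:
  fixes p :: real and \<D> :: "(real \<times> real) multiset set"
  assumes "1 \<le> p" and "finite \<D>" and "\<D> \<subseteq> diagrams"
  shows "\<exists>f. f \<in> \<D> \<rightarrow> wasserstein_space p \<and> inj_on f \<D> \<and>
    (\<forall>D\<in>\<D>. \<forall>E\<in>\<D>.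
       wasserstein_diagram p D E \<le> wasserstein_measure p (f D) (f E) \<and>
       wasserstein_measure p (f D) (f E) \<le> 2 powr (1 / p) * wasserstein_diagram p D E)"
proof -
  \<comment> \<open>An extra nonempty diagram excludes an empty index set.\<close>
  define \<D>' where "\<D>' = insert {#(0, 1)#} \<D>"
  have p: "0 < p" using assms(1) by simp
  have fin: "finite \<D>'" and sub: "\<D>' \<subseteq> diagrams" and incl: "\<D> \<subseteq> \<D>'"
    using assms by (auto simp: \<D>'_def diagrams_def)
  have "({#(0, 1)#}, (0, 1), 0) \<in> Sigma \<D>' tagged" by (simp add: \<D>'_def tagged_def)
  then have ne: "Sigma \<D>' tagged \<noteq> {}" by blast
  have finT: "finite (Sigma \<D>' tagged)" using fin by simp
  show ?thesis
  proof (intro exI[of _ "diagram_measure p \<D>'"] conjI ballI)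
    show "diagram_measure p \<D>' \<in> \<D> \<rightarrow> wasserstein_space p"
      unfolding diagram_measure_def using uniform_image_in_wasserstein_space[OF finT ne] by blast
    show "inj_on (diagram_measure p \<D>') \<D>"
      using inj_on_diagram_measure[OF fin ne sub] incl by (rule inj_on_subset)
  next
    fix D E assume "D \<in> \<D>" "E \<in> \<D>"
    then have "D \<in> \<D>'" "E \<in> \<D>'" using incl by auto
    then show "wasserstein_diagram p D E
        \<le> wasserstein_measure p (diagram_measure p \<D>' D) (diagram_measure p \<D>' E)"
      and "wasserstein_measure p (diagram_measure p \<D>' D) (diagram_measure p \<D>' E)
        \<le> 2 powr (1 / p) * wasserstein_diagram p D E"
      using wasserstein_diagram_le_measure[OF p fin ne] wasserstein_measure_le_diagram[OF p fin ne]
      by blast+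
  qed
qed

end
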